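(* Let $\mu$ and $\tau$ be nonempty partitions with $|\mu|=|\tau|$ and $w_\mu=w_\tau$. Then the following are equivalent: (i) $\mu$ and $\tau$ are width-Wilf equivalent; (ii) $F_{\mu,1}(q)=F_{\tau,1}(q)$; (iii) $\mu$ and $\tau$ are rook equivalent.
   Context: A partition is a weakly decreasing sequence $\mu=(\mu_1,\mu_2,\ldots)$ of nonnegative integers with finitely many positive terms, identified with its Ferrers board; its weight is $|\mu|=\sum_i\mu_i$, its width is $w_\mu=\mu_1$, and it is nonempty if $\mu_1>0$. A partition $\alpha$ contains $\mu$ if deleting some rows and some columns of the Ferrers board of $\alpha$ yields the Ferrers board of $\mu$. For $k\ge0$, $\mathcal{P}_n(\mu,k)$ is the set of partitions of weight $n$ and width $w_\mu+k$ that contain $\mu$, and $F_{\mu,k}(q)=\sum_{n\ge0}|\mathcal{P}_n(\mu,k)|q^n$. Partitions $\mu,\tau$ are width-Wilf equivalent if for all $n$ and all $w$, the number of partitions of weight $n$ and width $w$ containing $\mu$ equals the number of those containing $\tau$. Two partitions are rook equivalent if for every $j\ge0$ their Ferrers boards admit the same number of placements of $j$ mutually non-attacking rooks. *)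

theory Defs
  imports "HOL-Computational_Algebra.Formal_Power_Series"
begin

text \<open>Partitions are sequences of natural numbers. Parts, and hence the rows and columns of
  Ferrers boards, are indexed from 0, so \<open>p 0\<close> is the largest part.\<close>

definition is_partition :: "(nat \<Rightarrow> nat) \<Rightarrow> bool" where
  "is_partition p \<longleftrightarrow> antimono p \<and> finite {i. p i > 0}"

definition weight :: "(nat \<Rightarrow> nat) \<Rightarrow> nat" where
  "weight p = (\<Sum>i | p i > 0. p i)"

definition width :: "(nat \<Rightarrow> nat) \<Rightarrow> nat" where
  "width p = p 0"

definition nonempty_partition :: "(nat \<Rightarrow> nat) \<Rightarrow> bool" where
  "nonempty_partition p \<longleftrightarrow> is_partition p \<and> p 0 > 0"

definition ferrers :: "(nat \<Rightarrow> nat) \<Rightarrow> (nat \<times> nat) set" where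
  "ferrers p = {(i, j). j < p i}"

text \<open>Deleting the rows in \<open>R\<close> and the columns in \<open>C\<close> of a board removes their cells and closes up
  the gaps: a surviving row (or column) gets as new index the number of surviving rows (columns)
  before it.\<close>

definition new_index :: "nat set \<Rightarrow> nat \<Rightarrow> nat" where
  "new_index D i = card {i'. i' < i \<and> i' \<notin> D}"

definition delete_lines :: "nat set \<Rightarrow> nat set \<Rightarrow> (nat \<times> nat) set \<Rightarrow> (nat \<times> nat) set" where
  "delete_lines R C B = {(new_index R i, new_index C j) | i j. (i, j) \<in> B \<and> i \<notin> R \<and> j \<notin> C}"

definition contains :: "(nat \<Rightarrow> nat) \<Rightarrow> (nat \<Rightarrow> nat) \<Rightarrow> bool" where
  "contains \<alpha> \<mu> \<longleftrightarrow> (\<exists>R C. delete_lines R C (ferrers \<alpha>) = ferrers \<mu>)"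

definition containers :: "(nat \<Rightarrow> nat) \<Rightarrow> nat \<Rightarrow> nat \<Rightarrow> (nat \<Rightarrow> nat) set" where
  "containers \<mu> n w = {\<alpha>. is_partition \<alpha> \<and> weight \<alpha> = n \<and> width \<alpha> = w \<and> contains \<alpha> \<mu>}"

definition P :: "nat \<Rightarrow> (nat \<Rightarrow> nat) \<Rightarrow> nat \<Rightarrow> (nat \<Rightarrow> nat) set" where
  "P n \<mu> k = containers \<mu> n (width \<mu> + k)"

definition F :: "(nat \<Rightarrow> nat) \<Rightarrow> nat \<Rightarrow> int fps" where
  "F \<mu> k = Abs_fps (\<lambda>n. int (card (P n \<mu> k)))"

definition width_Wilf_equivalent :: "(nat \<Rightarrow> nat) \<Rightarrow> (nat \<Rightarrow> nat) \<Rightarrow> bool" where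
  "width_Wilf_equivalent \<mu> \<tau> \<longleftrightarrow> (\<forall>n w. card (containers \<mu> n w) = card (containers \<tau> n w))"

definition rook_placements :: "(nat \<times> nat) set \<Rightarrow> nat \<Rightarrow> (nat \<times> nat) set set" where
  "rook_placements B j = {S. S \<subseteq> B \<and> finite S \<and> card S = j \<and>
     (\<forall>c\<in>S. \<forall>d\<in>S. c \<noteq> d \<longrightarrow> fst c \<noteq> fst d \<and> snd c \<noteq> snd d)}"

definition rook_equivalent :: "(nat \<Rightarrow> nat) \<Rightarrow> (nat \<Rightarrow> nat) \<Rightarrow> bool" where
  "rook_equivalent \<mu> \<tau> \<longleftrightarrow>
     (\<forall>j. card (rook_placements (ferrers \<mu>) j) = card (rook_placements (ferrers \<tau>) j))"

end

theory Submission
  imports Defs "HOL-Library.Sublist" "HOL-Library.Multiset"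
    "HOL-Computational_Algebra.Polynomial"
begin

text \<open>Let \<open>h\<^sub>l\<close> be the height of column \<open>l\<close> of \<open>\<mu>\<close>, for \<open>1 \<le> l \<le> w\<close>. All three conditions
  amount to equality of the multisets of labels \<open>h\<^sub>l + l\<close>. For rook equivalence this is the
  Goldman--Joichi--White factorization of the rook polynomial in the falling factorial basis.

  For containment, let \<open>x\<^sub>k\<close> be the generating function of the partitions of width at most \<open>w + k\<close>
  that contain \<open>\<mu>\<close>. Matching \<open>\<mu>\<close> greedily from its largest part, each row of length \<open>l\<close> acts on
  such sequences as \<open>q\<^sup>l A\<close>, where \<open>(A v)\<^sub>k = (\<Sum>d\<le>k. q\<^sup>d v\<^sub>d)\<close>, and the end of column \<open>l\<close> acts as
  the inverse of \<open>v\<^sub>k \<mapsto> (1 - q\<^bsup>l + k\<^esup>) v\<^sub>k\<close>. Commuting all the \<open>A\<close> to one side turns the latter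
  operator into \<open>D\<^sub>l\<^sub>,\<^sub>b = 1 - (q\<^sup>l - q\<^sup>b S) A\<close> with \<open>S\<close> the shift and \<open>b = h\<^sub>l + l\<close>, so
  \<open>D\<^sub>1 \<dots> D\<^sub>w x = q\<^bsup>|\<mu>|\<^esup> p\<close> where \<open>p\<^sub>k\<close> counts the partitions of width at most \<open>k\<close>. The product
  \<open>D\<^sub>l\<^sub>,\<^sub>b D\<^bsub>l+1,b'\<^esub>\<close> is symmetric in \<open>b\<close> and \<open>b'\<close>, and each factor is injective; hence \<open>x\<close> depends only
  on \<open>w\<close>, \<open>|\<mu>|\<close> and the multiset of labels. Conversely \<open>x\<^sub>1\<close> reveals \<open>\<Sum>b. q\<^sup>b\<close>.\<close>

subsection \<open>Operators on sequences of power series\<close>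

text \<open>The operators A, S and \<open>D\<close> of the overview are \<open>wsum\<close>,
  \<open>shift\<close> and \<open>dop\<close>, with q for \<open>fps_X\<close>. In
  \<open>dprod l bs\<close> the first index rises by one per factor, while the labels are taken from
  the list.\<close>

definition wsum :: "(nat \<Rightarrow> int fps) \<Rightarrow> nat \<Rightarrow> int fps" where
  "wsum v k = (\<Sum>d\<le>k. fps_X ^ d * v d)"

definition shift :: "(nat \<Rightarrow> int fps) \<Rightarrow> nat \<Rightarrow> int fps" where
  "shift v k = (if k = 0 then 0 else v (k - 1))"

definition dop :: "nat \<Rightarrow> nat \<Rightarrow> (nat \<Rightarrow> int fps) \<Rightarrow> nat \<Rightarrow> int fps" where
  "dop l b v k = v k - fps_X ^ l * wsum v k + fps_X ^ b * shift (wsum v) k"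

fun dprod :: "nat \<Rightarrow> nat list \<Rightarrow> (nat \<Rightarrow> int fps) \<Rightarrow> nat \<Rightarrow> int fps" where
  "dprod l [] v = v"
| "dprod l (b # bs) v = dop l b (dprod (Suc l) bs v)"

lemma wsum_0: "wsum v 0 = v 0"
  by (simp add: wsum_def)

lemma wsum_Suc: "wsum v (Suc k) = wsum v k + fps_X ^ Suc k * v (Suc k)"
  by (simp add: wsum_def)

lemma shift_simps [simp]: "shift v 0 = 0" "shift v (Suc k) = v k"
  by (simp_all add: shift_def)

lemma wsum_smult: "wsum (\<lambda>k. c * v k) = (\<lambda>k. c * wsum v k)"
  by (simp add: wsum_def fun_eq_iff sum_distrib_left mult.left_commute)

lemma funpow_wsum_smult: "(wsum ^^ h) (\<lambda>k. c * v k) = (\<lambda>k. c * (wsum ^^ h) v k)"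
  by (induction h) (simp_all add: wsum_smult)

lemma shift_smult: "shift (\<lambda>k. c * v k) = (\<lambda>k. c * shift v k)"
  by (simp add: shift_def fun_eq_iff)

lemma dop_smult: "dop l b (\<lambda>k. c * v k) = (\<lambda>k. c * dop l b v k)"
  by (simp add: dop_def fun_eq_iff wsum_smult shift_smult algebra_simps)

lemma dprod_smult: "dprod l bs (\<lambda>k. c * v k) = (\<lambda>k. c * dprod l bs v k)"
  by (induction bs arbitrary: l) (simp_all add: dop_smult)

text \<open>Moving a sequence one place to the right raises every weight by one degree, hence A S =
  q S A.\<close>

lemma wsum_shift: "wsum (shift v) k = fps_X * shift (wsum v) k"
proof (induction k)
  case (Suc k)
  then show ?case by (cases k) (simp_all add: wsum_0 wsum_Suc algebra_simps)
qed (simp add: wsum_0)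

text \<open>By A S = q S A, only the coefficient of S changes when A passes \<open>dop\<close>. This
  is how each row of \<mu> adds one to the labels of the columns it covers.\<close>

lemma wsum_dop: "wsum (dop l b v) = dop l (Suc b) (wsum v)"
proof
  fix k
  have "wsum (dop l b v) k =
      wsum v k - fps_X ^ l * wsum (wsum v) k + fps_X ^ b * wsum (shift (wsum v)) k"
    by (simp add: wsum_def[of "dop l b v"] dop_def algebra_simps sum.distrib sum_subtractf)
       (simp add: wsum_def[of "wsum v"] wsum_def[of "shift (wsum v)"] wsum_def[of v]
          sum_distrib_left algebra_simps)
  also have "\<dots> = dop l (Suc b) (wsum v) k"
    by (simp add: wsum_shift dop_def algebra_simps)
  finally show "wsum (dop l b v) k = dop l (Suc b) (wsum v) k" .
qed

text \<open>Consecutive partial sums differ by one term, so (1 - S) A is multiplication by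
  q^k.\<close>

lemma dop_diag: "dop l l v k = (1 - fps_X ^ (l + k)) * v k"
  by (cases k) (simp_all add: dop_def wsum_0 wsum_Suc algebra_simps power_add)

lemma funpow_wsum_diag:
  "(wsum ^^ h) (\<lambda>k. (1 - fps_X ^ (l + k)) * v k) = dop l (l + h) ((wsum ^^ h) v)"
proof (induction h)
  case 0
  show ?case by (simp add: dop_diag fun_eq_iff)
next
  case (Suc h)
  then show ?case by (simp add: wsum_dop)
qed

section \<open>Symmetry of the operator product in its labels\<close>

lemma shift_dop: "shift (dop l b v) k =
    shift v k - fps_X ^ l * shift (wsum v) k + fps_X ^ b * shift (shift (wsum v)) k"
  by (cases k) (simp_all add: dop_def)

text \<open>The extra q that arises when A passes the inner \<open>dop\<close> is balanced by the
  inner index being \<open>Suc l\<close>, so the labels enter the expansion only through q^b + q^b'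
  and q^b q^b'.\<close>

lemma dop_swap: "dop l b (dop (Suc l) b' v) = dop l b' (dop (Suc l) b v)"
proof
  fix k
  have "dop l b (dop (Suc l) b' v) k =
      v k - (fps_X ^ l + fps_X ^ Suc l) * wsum v k + (fps_X ^ b + fps_X ^ b') * shift (wsum v) k
      + fps_X ^ l * fps_X ^ Suc l * wsum (wsum v) k
      - fps_X ^ Suc l * (fps_X ^ b + fps_X ^ b') * shift (wsum (wsum v)) k
      + fps_X ^ Suc b * fps_X ^ b' * shift (shift (wsum (wsum v))) k" (is "?L b b' = ?R b b'") for b b'
    unfolding dop_def[of l b] wsum_dop shift_dop by (simp add: dop_def algebra_simps)
  moreover have "?R b b' = ?R b' b" by (simp add: algebra_simps)
  ultimately show "?L b b' = ?L b' b" by metis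
qed

text \<open>Repeated use of \<open>dop_swap\<close>: the labels move, the indices stay with their
  positions.\<close>

lemma dprod_move: "dprod l (xs @ b # ys) = dprod l (b # xs @ ys)"
proof (induction xs arbitrary: l)
  case (Cons x xs)
  show ?case
    by (rule ext) (simp add: Cons.IH, simp add: dop_swap)
qed simp

lemma dprod_mset_cong: "mset bs = mset cs \<Longrightarrow> dprod l bs = dprod l cs"
proof (induction bs arbitrary: l cs)
  case (Cons b bs)
  then have "b \<in> set cs" by (metis list.set_intros(1) mset_eq_setD)
  then obtain ys zs where cs: "cs = ys @ b # zs" by (meson split_list)
  then have "dprod (Suc l) bs = dprod (Suc l) (ys @ zs)" using Cons by simp
  then show ?case by (intro ext) (simp add: cs dprod_move)
qed simp

lemma dprod_append: "dprod l (bs @ [b]) v = dprod l bs (dop (l + length bs) b v)"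
  by (induction bs arbitrary: l) simp_all

section \<open>Injectivity and the first two entries of the operator product\<close>

lemma one_minus_X_power_neq_0: "n > 0 \<Longrightarrow> 1 - fps_X ^ n \<noteq> (0 :: int fps)"
  by (metis diff_eq_diff_eq diff_zero fps_X_power_nth fps_one_nth less_numeral_extra(3) zero_neq_one eq_iff_diff_eq_0)

text \<open>The operator is triangular: entry k involves only entries up to k, and its diagonal
  coefficient 1 - q^(l+k) is nonzero because \<open>l > 0\<close>.\<close>

lemma dop_inj:
  assumes "l > 0" "dop l b u = dop l b v"
  shows "u = v"
proof
  fix k
  show "u k = v k"
  proof (induction k rule: less_induct)
    case (less k)
    show ?case
    proof (cases k)
      case 0
      have "dop l b u 0 = dop l b v 0" by (simp add: assms)
      then have "(1 - fps_X ^ l) * u 0 = (1 - fps_X ^ l) * v 0"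
        by (simp add: dop_def wsum_0 algebra_simps)
      then show ?thesis using one_minus_X_power_neq_0[OF assms(1)] 0 by simp
    next
      case (Suc j)
      have w: "wsum u j = wsum v j"
        unfolding wsum_def by (rule sum.cong) (auto simp: less Suc)
      have "dop l b u k = dop l b v k" by (simp add: assms)
      then have "(1 - fps_X ^ (l + k)) * u k = (1 - fps_X ^ (l + k)) * v k"
        by (simp add: dop_def Suc wsum_Suc w algebra_simps power_add)
      then show ?thesis using one_minus_X_power_neq_0[of "l + k"] assms(1) by simp
    qed
  qed
qed

lemma dprod_inj: "l > 0 \<Longrightarrow> dprod l bs u = dprod l bs v \<Longrightarrow> u = v"
  by (induction bs arbitrary: l) (auto dest: dop_inj)

lemma dprod_nth_0: "dprod l bs v 0 = (\<Prod>i=l..<l + length bs. 1 - fps_X ^ i) * v 0"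
  by (induction bs arbitrary: l)
     (simp_all add: dop_def wsum_0 prod.atLeast_Suc_lessThan algebra_simps)

text \<open>A label b at index i contributes q^b - q^i times the product of all 1 - q^j except j =
  l. The factor 1 - q^l completes this product, and the formula then covers the empty list too. The
  labels enter only through the sum of the q^b, from which they can be recovered.\<close>

lemma dprod_nth_1:
  "(1 - fps_X ^ l) * dprod l bs v 1 =
    (1 - fps_X ^ l) * (\<Prod>i=l..<l + length bs. 1 - fps_X ^ Suc i) * v 1 +
    (\<Prod>i=l..<l + length bs. 1 - fps_X ^ i) * 
      ((\<Sum>b\<leftarrow>bs. fps_X ^ b) - (\<Sum>i=l..<l + length bs. fps_X ^ i)) * v 0"
proof (induction bs arbitrary: l)
  case (Cons b bs)
  define u where "u = dprod (Suc l) bs v"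
  define C where "C = (\<Prod>i=Suc l..<Suc (l + length bs). 1 - (fps_X::int fps) ^ i)"
  define E where "E = (\<Prod>i=Suc l..<Suc (l + length bs). 1 - (fps_X::int fps) ^ Suc i)"
  define T where "T = (\<Sum>b\<leftarrow>bs. (fps_X :: int fps) ^ b) - (\<Sum>i=Suc l..<Suc (l + length bs). fps_X ^ i)"
  have u1: "(1 - fps_X ^ Suc l) * u 1 = (1 - fps_X ^ Suc l) * E * v 1 + C * T * v 0"
    using Cons.IH[of "Suc l"] by (simp add: u_def C_def E_def T_def)
  have u0: "u 0 = C * v 0"
    by (simp add: u_def C_def dprod_nth_0)
  have "dprod l (b # bs) v 1 = (1 - fps_X ^ Suc l) * u 1 + (fps_X ^ b - fps_X ^ l) * u 0"
    by (simp add: u_def[symmetric] dop_def wsum_def shift_def algebra_simps)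
  also have "\<dots> = (1 - fps_X ^ Suc l) * E * v 1 + C * (T + fps_X ^ b - fps_X ^ l) * v 0"
    unfolding u1 u0 by (simp add: algebra_simps)
  also have "(1 - fps_X ^ l) * \<dots> = (1 - fps_X ^ l) * ((1 - fps_X ^ Suc l) * E) * v 1
      + ((1 - fps_X ^ l) * C) * (fps_X ^ b + T - fps_X ^ l) * v 0"
    by (simp only: algebra_simps)
  also have "(1 - fps_X ^ Suc l) * E = (\<Prod>i=l..<l + length (b # bs). 1 - fps_X ^ Suc i)"
    by (simp add: E_def prod.atLeast_Suc_lessThan del: prod.op_ivl_Suc power_Suc)
  also have "(1 - fps_X ^ l) * C = (\<Prod>i=l..<l + length (b # bs). 1 - fps_X ^ i)"
    by (simp add: C_def prod.atLeast_Suc_lessThan del: prod.op_ivl_Suc)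
  also have "fps_X ^ b + T - fps_X ^ l =
      (\<Sum>b\<leftarrow>b # bs. fps_X ^ b) - (\<Sum>i=l..<l + length (b # bs). fps_X ^ i)"
    by (simp add: T_def sum.atLeast_Suc_lessThan del: sum.op_ivl_Suc)
  finally show ?case .
qed simp

subsection \<open>Recursion for the generating functions\<close>

text \<open>Partitions of width at most \<open>N\<close>, as lists of their positive parts.\<close>

definition descending :: "nat \<Rightarrow> nat list set" where
  "descending N = {xs. sorted_wrt (\<ge>) xs \<and> set xs \<subseteq> {1..N}}"

text \<open>Containment of partitions given by their lists of parts, where \<open>S\<close> is the set of the \<open>w\<close>
  surviving columns. Fixing \<open>w\<close> separately lets \<open>ms\<close> have width less than \<open>w\<close>, as happens in the
  recursion after its longest rows have been matched.\<close>

definition fits :: "nat \<Rightarrow> nat \<Rightarrow> nat list \<Rightarrow> nat list \<Rightarrow> bool" where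
  "fits N w ms xs \<longleftrightarrow>
     (\<exists>S. S \<subseteq> {..<N} \<and> card S = w \<and> subseq ms (map (\<lambda>x. card (S \<inter> {..<x})) xs))"

definition fitting :: "nat \<Rightarrow> nat \<Rightarrow> nat list \<Rightarrow> nat list set" where
  "fitting N w ms = {xs \<in> descending N. fits N w ms xs}"

definition gf :: "nat list set \<Rightarrow> int fps" where
  "gf L = Abs_fps (\<lambda>n. int (card {xs \<in> L. sum_list xs = n}))"

lemma length_le_sum_list: "0 \<notin> set xs \<Longrightarrow> length xs \<le> sum_list (xs :: nat list)"
  by (induction xs) auto

text \<open>Positive parts bound the length by the weight. Finiteness makes the \<open>card\<close>
  in \<open>gf\<close> a genuine count.\<close>

lemma finite_descending_sum:
  assumes "L \<subseteq> descending N"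
  shows "finite {xs \<in> L. sum_list xs = n}"
proof (rule finite_subset)
  show "{xs \<in> L. sum_list xs = n} \<subseteq> {xs. set xs \<subseteq> {1..N} \<and> length xs \<le> n}"
  proof
    fix xs assume xs: "xs \<in> {xs \<in> L. sum_list xs = n}"
    then have "set xs \<subseteq> {1..N}" using assms by (auto simp: descending_def)
    moreover from this have "length xs \<le> sum_list xs" by (intro length_le_sum_list) auto
    ultimately show "xs \<in> {xs. set xs \<subseteq> {1..N} \<and> length xs \<le> n}" using xs by simp
  qed
qed (simp add: finite_lists_length_le)

lemma fitting_subset: "fitting N w ms \<subseteq> descending N"
  by (auto simp: fitting_def)

lemma gf_Un_Cons:
  assumes "L \<subseteq> descending N" "M \<subseteq> descending (Suc N)"
  shows "gf (L \<union> Cons (Suc N) ` M) = gf L + fps_X ^ Suc N * gf M"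
proof (rule fps_ext)
  fix n
  define A where "A = {xs \<in> L. sum_list xs = n}"
  define B where "B = {xs \<in> M. Suc N + sum_list xs = n}"
  have "finite A" unfolding A_def by (rule finite_descending_sum[OF assms(1)])
  moreover have B: "B = (if n < Suc N then {} else {xs \<in> M. sum_list xs = n - Suc N})"
    by (auto simp: B_def)
  then have "finite B" using finite_descending_sum[OF assms(2)] by simp
  moreover have "A \<inter> Cons (Suc N) ` B = {}"
    using assms(1) by (force simp: A_def descending_def)
  ultimately have "card (A \<union> Cons (Suc N) ` B) = card A + card B"
    by (subst card_Un_disjoint) (simp_all add: card_image)
  moreover have "{xs \<in> L \<union> Cons (Suc N) ` M. sum_list xs = n} = A \<union> Cons (Suc N) ` B"
    by (auto simp: A_def B_def)
  moreover have "fps_nth (fps_X ^ Suc N * gf M) n = int (card B)"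
    unfolding fps_X_power_mult_nth by (simp add: gf_def B)
  ultimately show "fps_nth (gf (L \<union> Cons (Suc N) ` M)) n = fps_nth (gf L + fps_X ^ Suc N * gf M) n"
    by (simp add: gf_def A_def del: power_Suc)
qed

lemma Nil_in_descending: "[] \<in> descending N"
  by (simp add: descending_def)

lemma Cons_in_descending:
  "x # xs \<in> descending N \<longleftrightarrow> 1 \<le> x \<and> x \<le> N \<and> xs \<in> descending x"
  by (auto simp: descending_def)

lemma descending_Suc: "descending (Suc N) = descending N \<union> Cons (Suc N) ` descending (Suc N)"
proof (rule set_eqI)
  fix xs
  show "xs \<in> descending (Suc N) \<longleftrightarrow> xs \<in> descending N \<union> Cons (Suc N) ` descending (Suc N)"
    by (cases xs) (auto simp: Nil_in_descending Cons_in_descending le_Suc_eq)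
qed

text \<open>Case split on whether the largest part equals \<open>Suc N\<close>; the assumptions name
  the fitting problem that remains in each case. Both recursions below are instances.\<close>

lemma fitting_Suc:
  assumes 1: "\<And>xs. xs \<in> descending N \<Longrightarrow> fits (Suc N) w ms xs \<longleftrightarrow> fits N w' ms' xs"
    and 2: "\<And>xs. xs \<in> descending (Suc N) \<Longrightarrow>
        fits (Suc N) w ms (Suc N # xs) \<longleftrightarrow> fits (Suc N) w'' ms'' xs"
  shows "gf (fitting (Suc N) w ms) =
    gf (fitting N w' ms') + fps_X ^ Suc N * gf (fitting (Suc N) w'' ms'')"
proof -
  have "fitting (Suc N) w ms = fitting N w' ms' \<union> Cons (Suc N) ` fitting (Suc N) w'' ms''"
    unfolding fitting_def by (subst descending_Suc) (use 1 2 in blast)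
  then show ?thesis by (simp add: gf_Un_Cons fitting_subset)
qed

lemma card_Int_lessThan_eq:
  assumes "finite S" "card (S \<inter> {..<x::nat}) = card S"
  shows "S \<subseteq> {..<x}"
  using assms card_subset_eq[of S "S \<inter> {..<x}"] by auto

text \<open>Greedy matching: a row in which \<open>w\<close> is matched covers all of
  \<open>S\<close>, hence so does the longest row \<open>x\<close>, which may be used instead. Since
  \<open>S\<close> then lies below \<open>x\<close>, the bound \<open>N\<close> can be replaced by
  \<open>x\<close>.\<close>

lemma fits_Cons_top:
  assumes "x # xs \<in> descending N" "w > 0"
  shows "fits N w (w # ms) (x # xs) \<longleftrightarrow> fits x w ms xs"
proof
  assume "fits N w (w # ms) (x # xs)"
  then obtain S where S: "S \<subseteq> {..<N}" "card S = w"
    and sub: "subseq (w # ms) (map (\<lambda>x. card (S \<inter> {..<x})) (x # xs))"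
    unfolding fits_def by blast
  have fin: "finite S" using S(1) finite_subset by blast
  have "w \<in> set (map (\<lambda>x. card (S \<inter> {..<x})) (x # xs))"
    by (rule list_emb_set[OF sub list.set_intros(1)]) simp
  then obtain y where y: "y \<in> set (x # xs)" "card (S \<inter> {..<y}) = w" by auto
  then have "S \<subseteq> {..<y}" using card_Int_lessThan_eq[OF fin] S by simp
  moreover have "y \<le> x" using y assms by (auto simp: descending_def)
  ultimately have Sx: "S \<subseteq> {..<x}" by auto
  then have "card (S \<inter> {..<x}) = w" using S by (simp add: Int_absorb2)
  then have "subseq ms (map (\<lambda>x. card (S \<inter> {..<x})) xs)" using sub by simp
  then show "fits x w ms xs" using Sx S unfolding fits_def by blast
next
  assume "fits x w ms xs"
  then obtain S where S: "S \<subseteq> {..<x}" "card S = w"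
    and sub: "subseq ms (map (\<lambda>x. card (S \<inter> {..<x})) xs)"
    unfolding fits_def by blast
  then have "subseq (w # ms) (map (\<lambda>x. card (S \<inter> {..<x})) (x # xs))"
    by (simp add: Int_absorb2)
  moreover have "S \<subseteq> {..<N}" using S assms by (auto simp: descending_def)
  ultimately show "fits N w (w # ms) (x # xs)" using S unfolding fits_def by blast
qed

lemma fits_Nil: "\<not> fits N w (m # ms) []"
  by (simp add: fits_def)

text \<open>By \<open>fits_Cons_top\<close> a list with first part at most \<open>N\<close> fits
  regardless of the bound, while a first part \<open>Suc N\<close> absorbs the row
  \<open>w\<close>.\<close>

lemma gf_fitting_top:
  assumes "w > 0"
  shows "gf (fitting (Suc N) w (w # ms)) =
    gf (fitting N w (w # ms)) + fps_X ^ Suc N * gf (fitting (Suc N) w ms)"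
proof (rule fitting_Suc)
  fix xs assume xs: "xs \<in> descending N"
  then have "xs \<in> descending (Suc N)" using descending_Suc by blast
  with xs show "fits (Suc N) w (w # ms) xs \<longleftrightarrow> fits N w (w # ms) xs"
    using assms by (cases xs) (simp_all add: fits_Cons_top fits_Nil)
next
  fix xs assume "xs \<in> descending (Suc N)"
  then have "Suc N # xs \<in> descending (Suc N)" by (auto simp: descending_def)
  then show "fits (Suc N) w (w # ms) (Suc N # xs) \<longleftrightarrow> fits (Suc N) w ms xs"
    using assms by (simp add: fits_Cons_top)
qed

text \<open>A further column \<open>N\<close> can be kept at no cost because no row of
  \<open>xs\<close> reaches it. Conversely the last kept column can be given up, since no row of
  \<open>ms\<close> uses it.\<close>

lemma fits_drop_column:
  assumes xs: "xs \<in> descending N" and ms: "\<And>m. m \<in> set ms \<Longrightarrow> m \<le> w"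
  shows "fits (Suc N) (Suc w) ms xs \<longleftrightarrow> fits N w ms xs"
proof
  assume "fits N w ms xs"
  then obtain S where S: "S \<subseteq> {..<N}" "card S = w"
    and sub: "subseq ms (map (\<lambda>x. card (S \<inter> {..<x})) xs)"
    unfolding fits_def by blast
  have "insert N S \<subseteq> {..<Suc N}" using S by auto
  moreover have "card (insert N S) = Suc w"
    using S by (metis card_insert_disjoint finite_lessThan finite_subset lessThan_iff less_irrefl subsetD)
  moreover have "map (\<lambda>x. card (insert N S \<inter> {..<x})) xs = map (\<lambda>x. card (S \<inter> {..<x})) xs"
    using xs by (auto simp: descending_def Int_insert_left)
  ultimately show "fits (Suc N) (Suc w) ms xs"
    using sub unfolding fits_def by metis
next
  assume "fits (Suc N) (Suc w) ms xs"
  then obtain S where S: "S \<subseteq> {..<Suc N}" "card S = Suc w"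
    and sub: "subseq ms (map (\<lambda>x. card (S \<inter> {..<x})) xs)"
    unfolding fits_def by blast
  have fin: "finite S" using S(1) finite_subset by blast
  define s where "s = Max S"
  have s: "s \<in> S" "\<And>t. t \<in> S \<Longrightarrow> t \<le> s"
    using fin S(2) by (auto simp: s_def intro!: Max_in)
  have "S - {s} \<subseteq> {..<N}"
  proof
    fix t assume t: "t \<in> S - {s}"
    then have "t < s" using s(2)[of t] by auto
    then show "t \<in> {..<N}" using s(1) S(1) by auto
  qed
  moreover have "card (S - {s}) = w" using S s by simp
  moreover have "subseq ms (map (\<lambda>x. card ((S - {s}) \<inter> {..<x})) xs)"
  proof -
    \<comment> \<open>Only rows with count at most \<open>w\<close> can be matched, and these do not
      reach the last kept column \<open>s\<close>; removing \<open>s\<close> leaves their counts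
      unchanged.\<close>
    let ?ys = "filter (\<lambda>x. card (S \<inter> {..<x}) \<le> w) xs"
    have eq: "S \<inter> {..<x} = (S - {s}) \<inter> {..<x}" if "x \<in> set ?ys" for x
    proof -
      have "\<not> S \<subseteq> {..<x}" using that S(2) by (auto simp: Int_absorb2)
      then obtain t where "t \<in> S" "x \<le> t" by (meson lessThan_iff linorder_not_less subsetI)
      then have "x \<le> s" using s(2)[of t] by simp
      then show ?thesis by auto
    qed
    have "subseq (filter (\<lambda>m. m \<le> w) ms) (filter (\<lambda>m. m \<le> w) (map (\<lambda>x. card (S \<inter> {..<x})) xs))"
      using sub by (rule subseq_filter)
    moreover have "filter (\<lambda>m. m \<le> w) ms = ms" using ms by (simp add: filter_id_conv)
    moreover have "filter (\<lambda>m. m \<le> w) (map (\<lambda>x. card (S \<inter> {..<x})) xs) =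
        map (\<lambda>x. card (S \<inter> {..<x})) ?ys"
      by (simp add: filter_map o_def)
    moreover have "\<dots> = map (\<lambda>x. card ((S - {s}) \<inter> {..<x})) ?ys"
      using eq by (intro map_cong) simp_all
    moreover have "subseq \<dots> (map (\<lambda>x. card ((S - {s}) \<inter> {..<x})) xs)"
      by (intro subseq_map) simp
    ultimately show ?thesis by (metis subseq_order.order_trans)
  qed
  ultimately show "fits N w ms xs" unfolding fits_def by blast
qed

text \<open>A row of full length \<open>N\<close> has count \<open>w\<close>, which exceeds every
  entry of \<open>ms\<close>, so it is never matched.\<close>

lemma fits_drop_row:
  assumes "\<And>m. m \<in> set ms \<Longrightarrow> m < w"
  shows "fits N w ms (N # xs) \<longleftrightarrow> fits N w ms xs"
proof -
  have "subseq ms (map (\<lambda>x. card (S \<inter> {..<x})) (N # xs)) \<longleftrightarrow>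
      subseq ms (map (\<lambda>x. card (S \<inter> {..<x})) xs)" if "S \<subseteq> {..<N}" "card S = w" for S
  proof (cases ms)
    case (Cons m ms')
    then have "m \<noteq> card (S \<inter> {..<N})" using assms[of m] that by (simp add: Int_absorb2)
    then show ?thesis using Cons by simp
  qed simp
  then show ?thesis unfolding fits_def by blast
qed

text \<open>Parts equal to \<open>Suc N\<close> can be prepended freely, which gives a geometric
  series. With N = w + k this is the diagonal operator for the end of column w + 1.\<close>

lemma gf_fitting_drop:
  assumes "\<And>m. m \<in> set ms \<Longrightarrow> m \<le> w"
  shows "(1 - fps_X ^ Suc N) * gf (fitting (Suc N) (Suc w) ms) = gf (fitting N w ms)"
proof -
  have "gf (fitting (Suc N) (Suc w) ms) =
      gf (fitting N w ms) + fps_X ^ Suc N * gf (fitting (Suc N) (Suc w) ms)"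
  proof (rule fitting_Suc)
    show "fits (Suc N) (Suc w) ms xs \<longleftrightarrow> fits N w ms xs" if "xs \<in> descending N" for xs
      using that assms by (rule fits_drop_column)
    show "fits (Suc N) (Suc w) ms (Suc N # xs) \<longleftrightarrow> fits (Suc N) (Suc w) ms xs" for xs
      using assms by (intro fits_drop_row) (simp add: less_Suc_eq_le)
  qed
  then show ?thesis unfolding left_diff_distrib mult_1_left by (metis add_diff_cancel_right')
qed

lemma fitting_0: "fitting N 0 [] = descending N"
proof -
  have "fits N 0 [] xs" for xs unfolding fits_def by (rule exI[of _ "{}"]) simp
  then show ?thesis by (simp add: fitting_def)
qed

lemma fitting_empty: "N < w \<Longrightarrow> fitting N w ms = {}"
proof -
  assume "N < w"
  then have "\<not> fits N w ms xs" for xs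
    unfolding fits_def using card_mono[OF finite_lessThan, of _ N] by (metis card_lessThan leD)
  then show ?thesis by (simp add: fitting_def)
qed

lemma gf_descending_Suc:
  "gf (descending N) + fps_X ^ Suc N * gf (descending (Suc N)) = gf (descending (Suc N))"
  by (metis descending_Suc gf_Un_Cons order_refl)

lemma gf_descending_0: "gf (descending 0) = 1"
proof -
  have "{xs \<in> descending 0. sum_list xs = n} = (if n = 0 then {[]} else {})" for n
    by (auto simp: descending_def)
  then show ?thesis by (auto simp: gf_def fps_eq_iff)
qed

text \<open>Classify partitions by their largest part d; the term d = 0 is the empty
  partition.\<close>

lemma wsum_gf_descending: "wsum (\<lambda>k. gf (descending k)) = (\<lambda>k. gf (descending k))"
proof
  show "wsum (\<lambda>k. gf (descending k)) k = gf (descending k)" for k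
  proof (induction k)
    case (Suc k)
    then show ?case unfolding wsum_Suc by (metis gf_descending_Suc)
  qed (simp add: wsum_0)
qed

lemma funpow_wsum_gf_descending: "(wsum ^^ h) (\<lambda>k. gf (descending k)) = (\<lambda>k. gf (descending k))"
  by (induction h) (simp_all add: wsum_gf_descending)

text \<open>Iterates \<open>gf_fitting_top\<close> in k. The sum starts at 0 because
  \<open>w\<close> columns cannot be chosen from w - 1.\<close>

lemma gf_fitting_row:
  assumes "w > 0"
  shows "(\<lambda>k. gf (fitting (w + k) w (w # ms))) =
    (\<lambda>k. fps_X ^ w * wsum (\<lambda>k. gf (fitting (w + k) w ms)) k)"
proof (rule ext)
  obtain u where u: "w = Suc u" using assms gr0_implies_Suc by blast
  have e: "gf (fitting u w (w # ms)) = 0"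
    by (simp add: fitting_empty u gf_def fps_eq_iff)
  show "gf (fitting (w + k) w (w # ms)) =
      fps_X ^ w * wsum (\<lambda>k. gf (fitting (w + k) w ms)) k" for k
  proof (induction k)
    case 0
    show ?case using gf_fitting_top[OF assms, of u ms] e by (simp add: wsum_0 u)
  next
    case (Suc k)
    then show ?case using gf_fitting_top[OF assms, of "w + k" ms]
      by (simp add: wsum_Suc power_add algebra_simps)
  qed
qed

definition col_height :: "nat list \<Rightarrow> nat \<Rightarrow> nat" where
  "col_height ms l = length (filter (\<lambda>m. l \<le> m) ms)"

text \<open>The number \<open>h\<close> counts the operators A already collected from longer rows,
  which is needed for the induction: removing a row of length w turns \<open>h\<close> into
  \<open>Suc h\<close>, and when no such row is left, column w is removed.\<close>

lemma dprod_gf_fitting: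
  assumes "ms \<in> descending w"
  shows "dprod 1 (map (\<lambda>l. l + h + col_height ms l) [1..<Suc w])
      ((wsum ^^ h) (\<lambda>k. gf (fitting (w + k) w ms))) =
    (\<lambda>k. fps_X ^ sum_list ms * gf (descending k))"
  using assms
proof (induction w arbitrary: h ms)
  case 0
  then have "ms = []" by (auto simp: descending_def)
  then show ?case by (simp add: fitting_0 funpow_wsum_gf_descending)
next
  case (Suc w)
  \<comment> \<open>Column w + 1 has height 0, so its label is \<open>Suc w + h\<close>: its
    diagonal operator has passed the \<open>h\<close> collected operators A.\<close>
  have drop: "dprod 1 (map (\<lambda>l. l + h + col_height ms l) [1..<Suc (Suc w)])
      ((wsum ^^ h) (\<lambda>k. gf (fitting (Suc w + k) (Suc w) ms))) =
    (\<lambda>k. fps_X ^ sum_list ms * gf (descending k))" if ms: "ms \<in> descending w" for h ms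
  proof -
    have le: "m \<le> w" if "m \<in> set ms" for m using ms that by (auto simp: descending_def)
    then have "col_height ms (Suc w) = 0" by (simp add: col_height_def filter_empty_conv not_less_eq_eq)
    moreover have "[1..<Suc (Suc w)] = [1..<Suc w] @ [Suc w]" by simp
    ultimately have "dprod 1 (map (\<lambda>l. l + h + col_height ms l) [1..<Suc (Suc w)]) v =
        dprod 1 (map (\<lambda>l. l + h + col_height ms l) [1..<Suc w]) (dop (Suc w) (Suc w + h) v)" for v
      by (simp add: dprod_append del: upt_Suc)
    moreover have "dop (Suc w) (Suc w + h) ((wsum ^^ h) (\<lambda>k. gf (fitting (Suc w + k) (Suc w) ms))) =
        (wsum ^^ h) (\<lambda>k. gf (fitting (w + k) w ms))"
      unfolding funpow_wsum_diag[symmetric] using gf_fitting_drop[OF le] by simp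
    ultimately show ?thesis using Suc.IH[OF ms] by simp
  qed
  show ?case
    using Suc.prems
  proof (induction ms arbitrary: h)
    case Nil
    then show ?case by (intro drop) (simp add: descending_def)
  next
    case (Cons m ms)
    show ?case
    proof (cases "m = Suc w")
      case False
      with Cons.prems have "m # ms \<in> descending w" by (fastforce simp: descending_def)
      then show ?thesis by (rule drop)
    next
      case True
      have ms: "ms \<in> descending (Suc w)" using Cons.prems by (simp add: descending_def)
      \<comment> \<open>A row of full length adds one to every column height, which is absorbed by
        \<open>Suc h\<close>.\<close>
      have labels: "map (\<lambda>l. l + h + col_height (m # ms) l) [1..<Suc (Suc w)] =
          map (\<lambda>l. l + Suc h + col_height ms l) [1..<Suc (Suc w)]"
        by (intro map_cong) (auto simp: col_height_def True)
      have vec: "(wsum ^^ h) (\<lambda>k. gf (fitting (Suc w + k) (Suc w) (m # ms))) =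
          (\<lambda>k. fps_X ^ Suc w * (wsum ^^ Suc h) (\<lambda>k. gf (fitting (Suc w + k) (Suc w) ms)) k)"
        unfolding True gf_fitting_row[OF zero_less_Suc] funpow_wsum_smult
        by (simp only: funpow_Suc_right o_def)
      show ?thesis
        unfolding labels vec dprod_smult Cons.IH[OF ms]
        by (simp add: True power_add mult.assoc)
    qed
  qed
qed

subsection \<open>Ferrers boards and lists of parts\<close>

definition parts :: "(nat \<Rightarrow> nat) \<Rightarrow> nat list" where
  "parts p = map p [0..<card {i. p i > 0}]"

text \<open>Monotonicity makes each level set an initial segment. The case j = 0 counts the parts;
  general j gives the column heights.\<close>

lemma is_partition_less_iff:
  assumes "is_partition p"
  shows "j < p i \<longleftrightarrow> i < card {i. j < p i}"
proof -
  let ?S = "{i. j < p i}"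
  have anti: "antimono p" using assms by (simp add: is_partition_def)
  have fin: "finite ?S"
    by (rule finite_subset[of _ "{i. p i > 0}"]) (use assms in \<open>auto simp: is_partition_def\<close>)
  have sub: "?S \<subseteq> {..<card ?S}"
  proof
    fix i assume i: "i \<in> ?S"
    have "{..i} \<subseteq> ?S"
    proof
      fix k assume "k \<in> {..i}"
      then show "k \<in> ?S" using antimonoD[OF anti, of k i] i by simp
    qed
    then have "card {..i} \<le> card ?S" by (rule card_mono[OF fin])
    then show "i \<in> {..<card ?S}" by simp
  qed
  have "?S = {..<card ?S}" by (rule card_subset_eq[OF _ sub]) simp_all
  then show ?thesis by blast
qed

lemma nth_parts:
  assumes "is_partition p"
  shows "p i = (if i < length (parts p) then parts p ! i else 0)"
  using is_partition_less_iff[OF assms, of 0 i] by (cases "p i = 0") (simp_all add: parts_def)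

lemma sum_list_parts:
  assumes "is_partition p"
  shows "sum_list (parts p) = weight p"
proof -
  have "{i. p i > 0} = {..<card {i. p i > 0}}"
    by (intro set_eqI, unfold mem_Collect_eq lessThan_iff) (rule is_partition_less_iff[OF assms])
  then show ?thesis
    unfolding weight_def parts_def interv_sum_list_conv_sum_set_nat by (metis set_upt atLeast0LessThan)
qed

lemma parts_in_descending:
  assumes "is_partition p" "width p \<le> N"
  shows "parts p \<in> descending N"
proof -
  have anti: "antimono p" using assms by (simp add: is_partition_def)
  have "p i \<ge> 1 \<and> p i \<le> N" if "i < card {i. p i > 0}" for i
    using is_partition_less_iff[OF assms(1), of 0 i] that antimonoD[OF anti, of 0 i] assms(2)
    by (simp add: width_def Suc_le_eq)
  then show ?thesis
    using antimonoD[OF anti]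
    by (auto simp: descending_def parts_def sorted_wrt_iff_nth_less)
qed

lemma bij_betw_parts: "bij_betw parts {p. is_partition p \<and> width p \<le> N} (descending N)"
proof (rule bij_betwI')
  fix p r assume "p \<in> {p. is_partition p \<and> width p \<le> N}" "r \<in> {p. is_partition p \<and> width p \<le> N}"
  then show "parts p = parts r \<longleftrightarrow> p = r"
    using nth_parts[of p] nth_parts[of r] by (metis (no_types, lifting) ext mem_Collect_eq)
next
  fix p assume "p \<in> {p. is_partition p \<and> width p \<le> N}"
  then show "parts p \<in> descending N" by (simp add: parts_in_descending)
next
  fix xs assume xs: "xs \<in> descending N"
  define p where "p = (\<lambda>i. if i < length xs then xs ! i else 0)"
  have pos: "p i > 0 \<longleftrightarrow> i < length xs" for i
  proof -
    have "0 \<notin> set xs" using xs by (auto simp: descending_def)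
    then show ?thesis by (metis p_def gr0I less_numeral_extra(3) nth_mem)
  qed
  have "antimono p"
  proof
    fix i j :: nat assume "i \<le> j"
    then show "p j \<le> p i"
      using xs by (cases "i = j") (auto simp: p_def descending_def sorted_wrt_iff_nth_less)
  qed
  then have "is_partition p" by (simp add: is_partition_def pos)
  moreover have "width p \<le> N"
    using xs by (cases xs) (auto simp: p_def width_def descending_def)
  moreover have "parts p = xs"
    by (rule nth_equalityI) (auto simp: parts_def pos, simp add: p_def)
  ultimately show "\<exists>p \<in> {p. is_partition p \<and> width p \<le> N}. xs = parts p" by blast
qed

section \<open>Deletion of lines as a subsequence condition\<close>

lemma new_index_image: "new_index D ` ({..<n} - D) = {..<card ({..<n} - D)}"
proof (induction n)
  case (Suc n)
  have "new_index D n = card ({..<n} - D)"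
    unfolding new_index_def by (rule arg_cong[of _ _ card]) auto
  moreover have "{..<Suc n} - D = (if n \<in> D then {..<n} - D else insert n ({..<n} - D))"
    by (auto simp: less_Suc_eq)
  ultimately show ?case by (auto simp: Suc lessThan_Suc)
qed simp

lemma map_new_index: "map (new_index D) (filter (\<lambda>i. i \<notin> D) [0..<n]) = [0..<card ({..<n} - D)]"
proof (induction n)
  case (Suc n)
  have "new_index D n = card ({..<n} - D)"
    unfolding new_index_def by (rule arg_cong[of _ _ card]) auto
  moreover have "{..<Suc n} - D = (if n \<in> D then {..<n} - D else insert n ({..<n} - D))"
    by (auto simp: less_Suc_eq)
  ultimately show ?case by (simp add: Suc)
qed simp

lemma new_index_inj:
  assumes "i \<notin> D" "j \<notin> D" "new_index D i = new_index D j"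
  shows "i = j"
proof -
  have "new_index D i < new_index D j" if "i < j" "i \<notin> D" for i j
    unfolding new_index_def using that by (intro psubset_card_mono) auto
  then show ?thesis using assms by (metis less_irrefl nat_neq_iff)
qed

text \<open>Each surviving row becomes an initial segment after renumbering, so only its length
  matters. The second conjunct is needed because too few rows may survive to supply all nonempty
  rows of \<mu>.\<close>

lemma delete_lines_eq_ferrers_iff:
  "delete_lines R C (ferrers \<alpha>) = ferrers \<mu> \<longleftrightarrow>
    (\<forall>i. i \<notin> R \<longrightarrow> card ({..<\<alpha> i} - C) = \<mu> (new_index R i)) \<and>
    (\<forall>r. \<mu> r > 0 \<longrightarrow> (\<exists>i. i \<notin> R \<and> new_index R i = r))" (is "?L \<longleftrightarrow> ?R")
proof -
  have "(r, j) \<in> delete_lines R C (ferrers \<alpha>) \<longleftrightarrow>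
      (\<exists>i. i \<notin> R \<and> new_index R i = r \<and> j \<in> new_index C ` ({..<\<alpha> i} - C))" for r j
    by (auto simp: delete_lines_def ferrers_def)
  then have del: "(r, j) \<in> delete_lines R C (ferrers \<alpha>) \<longleftrightarrow>
      (\<exists>i. i \<notin> R \<and> new_index R i = r \<and> j < card ({..<\<alpha> i} - C))" for r j
    by (simp add: new_index_image)
  show ?thesis
  proof
    assume L: ?L
    have *: "j < \<mu> r \<longleftrightarrow> (\<exists>i. i \<notin> R \<and> new_index R i = r \<and> j < card ({..<\<alpha> i} - C))" for r j
      unfolding del[symmetric] L by (simp add: ferrers_def)
    have "j < \<mu> (new_index R i) \<longleftrightarrow> j < card ({..<\<alpha> i} - C)" if "i \<notin> R" for i j
      unfolding * using that new_index_inj by metis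
    then have "card ({..<\<alpha> i} - C) = \<mu> (new_index R i)" if "i \<notin> R" for i
      using that by (metis less_irrefl nat_neq_iff)
    then show ?R using * by blast
  next
    assume R: ?R
    show ?L
    proof (intro set_eqI)
      fix c :: "nat \<times> nat"
      obtain r j where c: "c = (r, j)" by force
      have "j < \<mu> r \<longleftrightarrow> (\<exists>i. i \<notin> R \<and> new_index R i = r \<and> j < card ({..<\<alpha> i} - C))"
        using R by (metis gr_implies_not0 gr0I)
      then show "c \<in> delete_lines R C (ferrers \<alpha>) \<longleftrightarrow> c \<in> ferrers \<mu>"
        unfolding c del by (simp add: ferrers_def)
    qed
  qed
qed

lemma nths_upt_filter: "nths [0..<n] K = filter (\<lambda>i. i \<in> K) [0..<n]"
  by (induction n) (simp_all add: nths_append)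

lemma contains_imp_fits:
  assumes \<alpha>: "is_partition \<alpha>" "width \<alpha> \<le> N" and \<mu>: "nonempty_partition \<mu>"
    and "contains \<alpha> \<mu>"
  shows "fits N (width \<mu>) (parts \<mu>) (parts \<alpha>)"
proof -
  obtain R C where "delete_lines R C (ferrers \<alpha>) = ferrers \<mu>"
    using assms(4) by (auto simp: contains_def)
  note del = this[unfolded delete_lines_eq_ferrers_iff]
  have rows: "card ({..<\<alpha> i} - C) = \<mu> (new_index R i)" if "i \<notin> R" for i
    using del that by blast
  have surj: "\<exists>i. i \<notin> R \<and> new_index R i = r" if "\<mu> r > 0" for r
    using del that by blast
  have part: "is_partition \<mu>" "\<mu> 0 > 0" using \<mu> by (auto simp: nonempty_partition_def)
  obtain i0 where i0: "i0 \<notin> R" "new_index R i0 = 0" using surj part(2) by blast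
  \<comment> \<open>Infinitely many columns may survive, but \<open>fits\<close> asks for exactly
    \<open>width \<mu>\<close>: take those meeting the row that becomes row 0 of \<mu>.\<close>
  define S where "S = {..<\<alpha> i0} - C"
  have cardS: "card S = width \<mu>" using rows[OF i0(1)] i0(2) by (simp add: S_def width_def)
  have "\<alpha> i0 \<le> N"
    using \<alpha> antimonoD[of \<alpha> 0 i0] by (simp add: is_partition_def width_def)
  then have SN: "S \<subseteq> {..<N}" by (auto simp: S_def)
  have count: "card (S \<inter> {..<\<alpha> i}) = \<mu> (new_index R i)" if "i \<notin> R" for i
  proof (cases "\<alpha> i \<le> \<alpha> i0")
    case True
    then have "S \<inter> {..<\<alpha> i} = {..<\<alpha> i} - C" by (auto simp: S_def)
    then show ?thesis using rows[OF that] by simp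
  next
    case False
    then have "S \<inter> {..<\<alpha> i} = S" by (auto simp: S_def)
    moreover have "S \<subseteq> {..<\<alpha> i} - C" using False by (auto simp: S_def)
    then have "width \<mu> \<le> \<mu> (new_index R i)"
      using card_mono[of "{..<\<alpha> i} - C" S] cardS rows[OF that] by simp
    moreover have "\<mu> (new_index R i) \<le> width \<mu>"
      using part(1) antimonoD[of \<mu> 0] by (simp add: is_partition_def width_def)
    ultimately show ?thesis using cardS by simp
  qed
  let ?M = "card {i. \<alpha> i > 0}" and ?L = "card {i. \<mu> i > 0}"
  let ?f = "\<lambda>x. card (S \<inter> {..<x})"
  let ?I = "filter (\<lambda>i. i \<notin> R) [0..<?M]" and ?n = "card ({..<?M} - R)"
  have "map ?f (map \<alpha> ?I) = map \<mu> (map (new_index R) ?I)"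
    by (simp add: count)
  also have "\<dots> = map \<mu> [0..<?n]" unfolding map_new_index ..
  finally have eq: "map ?f (map \<alpha> ?I) = map \<mu> [0..<?n]" .
  have "r < ?n" if "r < ?L" for r
  proof -
    have r: "\<mu> r > 0" using is_partition_less_iff[OF part(1), of 0 r] that by simp
    then obtain i where i: "i \<notin> R" "new_index R i = r" using surj by blast
    have "S \<inter> {..<\<alpha> i} \<noteq> {}" using count[OF i(1)] r i(2) by force
    then have "\<alpha> i > 0" by force
    then have "i \<in> {..<?M} - R" using is_partition_less_iff[OF \<alpha>(1), of 0 i] i(1) by simp
    then show "r < ?n" using new_index_image[of R ?M] i(2) by blast
  qed
  \<comment> \<open>Some surviving rows may become empty rows of \<mu>, so
    \<open>parts \<mu>\<close> is in general only a prefix of the list of surviving rows.\<close>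
  then have "?L \<le> ?n" by (meson less_irrefl not_less)
  then have "[0..<?n] = [0..<?L] @ [?L..<?n]" by (metis le_Suc_ex upt_add_eq_append zero_le)
  then have "subseq (parts \<mu>) (map \<mu> [0..<?n])" 
    unfolding parts_def by (metis map_append prefixI prefix_imp_subseq)
  also have "subseq (map \<mu> [0..<?n]) (map ?f (parts \<alpha>))"
    unfolding eq[symmetric] parts_def by (intro subseq_map) simp
  finally show ?thesis unfolding fits_def using SN cardS by blast
qed

lemma fits_imp_contains:
  assumes \<alpha>: "is_partition \<alpha>" and \<mu>: "is_partition \<mu>"
    and "fits N w (parts \<mu>) (parts \<alpha>)"
  shows "contains \<alpha> \<mu>"
proof -
  obtain S where sub: "subseq (parts \<mu>) (map (\<lambda>x. card (S \<inter> {..<x})) (parts \<alpha>))"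
    using assms(3) by (auto simp: fits_def)
  let ?M = "card {i. \<alpha> i > 0}" and ?L = "card {i. \<mu> i > 0}"
  let ?f = "\<lambda>x. card (S \<inter> {..<x})"
  obtain K where "parts \<mu> = nths (map ?f (parts \<alpha>)) K" using sub by (auto simp: subseq_conv_nths)
  then have K: "parts \<mu> = map ?f (map \<alpha> (filter (\<lambda>i. i \<in> K) [0..<?M]))"
    by (simp only: parts_def nths_map nths_upt_filter)
  \<comment> \<open>Deleting also all rows beyond the parts of \<alpha> leaves exactly the matched
    rows.\<close>
  define R where "R = - (K \<inter> {..<?M})"
  let ?I = "filter (\<lambda>i. i \<notin> R) [0..<?M]"
  have "filter (\<lambda>i. i \<in> K) [0..<?M] = ?I"
    by (rule filter_cong) (auto simp: R_def)
  then have I: "parts \<mu> = map ?f (map \<alpha> ?I)" using K by simp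
  have "length (map (new_index R) ?I) = card ({..<?M} - R)" unfolding map_new_index by simp
  moreover have "length (map (new_index R) ?I) = ?L"
    using arg_cong[OF I, of length] by (simp add: parts_def)
  ultimately have idx: "map (new_index R) ?I = [0..<?L]" by (simp add: map_new_index)
  have "map ?f (map \<alpha> ?I) = map \<mu> (map (new_index R) ?I)"
    unfolding I[symmetric] idx by (simp add: parts_def)
  then have "?f (\<alpha> i) = \<mu> (new_index R i)" if "i \<in> set ?I" for i
    using that unfolding map_map map_eq_conv by simp
  then have "?f (\<alpha> i) = \<mu> (new_index R i)" if "i \<notin> R" for i
    using that by (simp add: R_def)
  moreover have "{..<x} - (- S) = S \<inter> {..<x}" for x by auto
  moreover have "\<exists>i. i \<notin> R \<and> new_index R i = r" if "\<mu> r > 0" for r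
  proof -
    have "r \<in> set (map (new_index R) ?I)"
      unfolding idx using that is_partition_less_iff[OF \<mu>, of 0 r] by simp
    then show ?thesis by auto
  qed
  ultimately have "delete_lines R (- S) (ferrers \<alpha>) = ferrers \<mu>"
    by (simp add: delete_lines_eq_ferrers_iff)
  then show ?thesis unfolding contains_def by blast
qed

lemma contains_iff_fits:
  assumes "is_partition \<alpha>" "width \<alpha> \<le> N" "nonempty_partition \<mu>"
  shows "contains \<alpha> \<mu> \<longleftrightarrow> fits N (width \<mu>) (parts \<mu>) (parts \<alpha>)"
  using assms contains_imp_fits fits_imp_contains by (meson nonempty_partition_def)

section \<open>Counts of containing partitions and the multiset of labels\<close>

lemma card_containers_le:
  assumes "nonempty_partition \<mu>"
  defines "A \<equiv> \<lambda>n N. {\<alpha>. is_partition \<alpha> \<and> weight \<alpha> = n \<and> width \<alpha> \<le> N \<and> contains \<alpha> \<mu>}"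
  shows "finite (A n N)"
    and "int (card (A n N)) = fps_nth (gf (fitting N (width \<mu>) (parts \<mu>))) n"
proof -
  let ?B = "{xs \<in> fitting N (width \<mu>) (parts \<mu>). sum_list xs = n}"
  have "bij_betw parts {\<alpha> \<in> {p. is_partition p \<and> width p \<le> N}. weight \<alpha> = n \<and> contains \<alpha> \<mu>}
      {xs \<in> descending N. sum_list xs = n \<and> fits N (width \<mu>) (parts \<mu>) xs}"
    using bij_betw_parts
  proof (rule bij_betw_Collect)
    fix \<alpha> assume "\<alpha> \<in> {p. is_partition p \<and> width p \<le> N}"
    then show "sum_list (parts \<alpha>) = n \<and> fits N (width \<mu>) (parts \<mu>) (parts \<alpha>) \<longleftrightarrow>
        weight \<alpha> = n \<and> contains \<alpha> \<mu>"
      using assms(1) contains_iff_fits[of \<alpha> N \<mu>] by (auto simp: sum_list_parts)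
  qed
  then have bij: "bij_betw parts (A n N) ?B"
    unfolding A_def fitting_def by (simp add: conj_ac)
  have fin: "finite ?B" by (rule finite_descending_sum[OF fitting_subset])
  show "finite (A n N)" using bij_betw_finite[OF bij] fin by simp
  show "int (card (A n N)) = fps_nth (gf (fitting N (width \<mu>) (parts \<mu>))) n"
    using bij_betw_same_card[OF bij] by (simp add: gf_def)
qed

text \<open>Since \<open>fitting\<close> only bounds the width, an exact width is a difference of
  two bounds.\<close>

lemma card_containers_Suc:
  assumes "nonempty_partition \<mu>"
  shows "int (card (containers \<mu> n (Suc N))) =
    fps_nth (gf (fitting (Suc N) (width \<mu>) (parts \<mu>))) n - fps_nth (gf (fitting N (width \<mu>) (parts \<mu>))) n"
proof -
  let ?A = "\<lambda>N. {\<alpha>. is_partition \<alpha> \<and> weight \<alpha> = n \<and> width \<alpha> \<le> N \<and> contains \<alpha> \<mu>}"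
  have "?A (Suc N) = ?A N \<union> containers \<mu> n (Suc N)"
    by (auto simp: containers_def le_Suc_eq)
  moreover have "?A N \<inter> containers \<mu> n (Suc N) = {}"
    by (auto simp: containers_def)
  moreover have "finite (?A N)" "finite (containers \<mu> n (Suc N))"
    using card_containers_le(1)[OF assms, of n N] card_containers_le(1)[OF assms, of n "Suc N"]
    by (auto simp: containers_def elim: rev_finite_subset)
  ultimately have "card (?A (Suc N)) = card (?A N) + card (containers \<mu> n (Suc N))"
    by (simp only: card_Un_disjoint)
  then have "int (card (?A (Suc N))) = int (card (?A N)) + int (card (containers \<mu> n (Suc N)))"
    by simp
  then show ?thesis unfolding card_containers_le(2)[OF assms] by simp
qed

lemma containers_0:
  assumes "nonempty_partition \<mu>"
  shows "containers \<mu> n 0 = {}"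
proof -
  have "\<not> contains \<alpha> \<mu>" if "is_partition \<alpha>" "width \<alpha> = 0" for \<alpha>
  proof -
    have "fitting 0 (width \<mu>) (parts \<mu>) = {}"
      using assms by (intro fitting_empty) (simp add: width_def nonempty_partition_def)
    then show ?thesis
      using contains_iff_fits[of \<alpha> 0 \<mu>] parts_in_descending[of \<alpha> 0] that assms
      by (auto simp: fitting_def)
  qed
  then show ?thesis by (auto simp: containers_def)
qed

lemma fps_sum_list_X_power_nth:
  "fps_nth (\<Sum>b\<leftarrow>bs. fps_X ^ b :: int fps) n = int (count (mset bs) n)"
  by (induction bs) (auto simp: fps_X_power_nth)

definition labels :: "(nat \<Rightarrow> nat) \<Rightarrow> nat list" where
  "labels \<mu> = map (\<lambda>l. l + col_height (parts \<mu>) l) [1..<Suc (width \<mu>)]"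

lemma dprod_labels:
  assumes "nonempty_partition \<mu>"
  shows "dprod 1 (labels \<mu>) (\<lambda>k. gf (fitting (width \<mu> + k) (width \<mu>) (parts \<mu>))) =
    (\<lambda>k. fps_X ^ weight \<mu> * gf (descending k))"
  using dprod_gf_fitting[of "parts \<mu>" "width \<mu>" 0] assms
  by (simp add: labels_def parts_in_descending sum_list_parts nonempty_partition_def)

lemma labels_imp_width_Wilf:
  assumes \<mu>: "nonempty_partition \<mu>" and \<tau>: "nonempty_partition \<tau>"
    and wt: "weight \<mu> = weight \<tau>" and wd: "width \<mu> = width \<tau>"
    and eq: "mset (labels \<mu>) = mset (labels \<tau>)"
  shows "width_Wilf_equivalent \<mu> \<tau>"
proof -
  let ?x = "\<lambda>\<mu> N. gf (fitting N (width \<mu>) (parts \<mu>))"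
  \<comment> \<open>Both sides equal q^|\<mu>| p, and by symmetry the labels of \<tau> may be
    replaced by those of \<mu>.\<close>
  have "dprod 1 (labels \<mu>) (\<lambda>k. ?x \<mu> (width \<mu> + k)) = dprod 1 (labels \<mu>) (\<lambda>k. ?x \<tau> (width \<mu> + k))"
    using dprod_labels[OF \<mu>] dprod_labels[OF \<tau>] dprod_mset_cong[OF eq] wt wd by simp
  then have large: "?x \<mu> (width \<mu> + k) = ?x \<tau> (width \<mu> + k)" for k
    by (metis dprod_inj zero_less_one)
  have "?x \<mu> N = ?x \<tau> N" for N
  proof (cases "N < width \<mu>")
    case True
    then show ?thesis using wd by (simp add: fitting_empty)
  next
    case False
    then show ?thesis using large[of "N - width \<mu>"] by simp
  qed
  then have "int (card (containers \<mu> n (Suc N))) = int (card (containers \<tau> n (Suc N)))" for n N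
    by (simp only: card_containers_Suc[OF \<mu>] card_containers_Suc[OF \<tau>])
  then have "card (containers \<mu> n w) = card (containers \<tau> n w)" for n w
    by (cases w) (simp_all add: containers_0[OF \<mu>] containers_0[OF \<tau>])
  then show ?thesis by (simp add: width_Wilf_equivalent_def)
qed

lemma F_imp_labels:
  assumes \<mu>: "nonempty_partition \<mu>" and \<tau>: "nonempty_partition \<tau>"
    and wt: "weight \<mu> = weight \<tau>" and wd: "width \<mu> = width \<tau>"
    and eq: "F \<mu> 1 = F \<tau> 1"
  shows "mset (labels \<mu>) = mset (labels \<tau>)"
proof -
  let ?x = "\<lambda>\<mu> k. gf (fitting (width \<mu> + k) (width \<mu>) (parts \<mu>))"
  let ?p = "\<Prod>i=1..<1 + width \<mu>. 1 - (fps_X :: int fps) ^ i"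
  have len: "length (labels \<mu>) = width \<mu>" "length (labels \<tau>) = width \<mu>"
    by (simp_all add: labels_def wd)
  have "1 - (fps_X :: int fps) ^ i \<noteq> 0" if "i \<in> {1..<1 + width \<mu>}" for i
    using that by (intro one_minus_X_power_neq_0) simp
  then have p: "?p \<noteq> 0" by (metis finite_atLeastLessThan prod_zero_iff)
  have D: "dprod 1 (labels \<mu>) (?x \<mu>) = dprod 1 (labels \<tau>) (?x \<tau>)"
    unfolding dprod_labels[OF \<mu>] dprod_labels[OF \<tau>] wt ..
  \<comment> \<open>Entry 0 depends only on weight and width, and it is nonzero, so it can be
    cancelled at the end.\<close>
  have init: "?p * ?x \<mu> 0 = fps_X ^ weight \<mu>"
    using fun_cong[OF dprod_labels[OF \<mu>], of 0] len by (simp add: dprod_nth_0 gf_descending_0)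
  then have x0_neq: "?x \<mu> 0 \<noteq> 0" by (metis fps_X_neq_zero mult_zero_right power_not_zero)
  have "?p * ?x \<mu> 0 = ?p * ?x \<tau> 0"
    using fun_cong[OF D, of 0] len by (simp add: dprod_nth_0)
  then have x0: "?x \<mu> 0 = ?x \<tau> 0" using p by simp
  have "F \<mu> 1 = ?x \<mu> 1 - ?x \<mu> 0" if "nonempty_partition \<mu>" for \<mu>
    using card_containers_Suc[OF that] by (simp add: F_def P_def fps_eq_iff)
  then have "?x \<mu> 1 = ?x \<tau> 1" using \<mu> \<tau> eq x0 by simp
  \<comment> \<open>In \<open>dprod_nth_1\<close> the left sides agree and so do the terms with
    entry 1; what remains compares the sums of the q^b.\<close>
  then have "?p * ((\<Sum>b\<leftarrow>labels \<mu>. fps_X ^ b) - (\<Sum>i=1..<1 + width \<mu>. fps_X ^ i)) * ?x \<mu> 0 =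
      ?p * ((\<Sum>b\<leftarrow>labels \<tau>. fps_X ^ b) - (\<Sum>i=1..<1 + width \<mu>. fps_X ^ i)) * ?x \<mu> 0"
    using dprod_nth_1[of 1 "labels \<mu>" "?x \<mu>"] dprod_nth_1[of 1 "labels \<tau>" "?x \<tau>"]
    unfolding D len x0 by simp
  then have "(\<Sum>b\<leftarrow>labels \<mu>. fps_X ^ b) = (\<Sum>b\<leftarrow>labels \<tau>. fps_X ^ b :: int fps)"
    using p x0_neq by simp
  then have "int (count (mset (labels \<mu>)) n) = int (count (mset (labels \<tau>)) n)" for n
    unfolding fps_sum_list_X_power_nth[symmetric] by simp
  then show ?thesis by (simp add: multiset_eq_iff)
qed

subsection \<open>Rook placements\<close>

lemma card_image_rook_placement:
  assumes "S \<in> rook_placements B k"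
  shows "card (fst ` S) = k" "card (snd ` S) = k"
proof -
  have card: "card S = k"
    and rook: "\<And>c d. c \<in> S \<Longrightarrow> d \<in> S \<Longrightarrow> c \<noteq> d \<Longrightarrow> fst c \<noteq> fst d \<and> snd c \<noteq> snd d"
    using assms unfolding rook_placements_def by blast+
  have "inj_on fst S" "inj_on snd S"
    by (rule inj_onI, use rook in blast)+
  with card show "card (fst ` S) = k" "card (snd ` S) = k" by (simp_all add: card_image)
qed

lemma finite_rook_placements: "finite B \<Longrightarrow> finite (rook_placements B k)"
  by (rule finite_subset[of _ "Pow B"]) (auto simp: rook_placements_def)

lemma rook_placements_0: "rook_placements B 0 = {{}}"
  by (auto simp: rook_placements_def)

lemma card_rook_placements_eq_0:
  assumes "finite B" "card (snd ` B) < k"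
  shows "card (rook_placements B k) = 0"
proof -
  have False if S: "S \<in> rook_placements B k" for S
  proof -
    have "snd ` S \<subseteq> snd ` B" using S by (auto simp: rook_placements_def)
    then have "card (snd ` S) \<le> card (snd ` B)" using assms(1) by (simp add: card_mono)
    then show False using card_image_rook_placement(2)[OF S] assms(2) by simp
  qed
  then have "rook_placements B k = {}" by blast
  then show ?thesis by simp
qed

text \<open>Either column \<open>c\<close> stays empty, or its rook avoids the k rows already taken,
  all of which lie below \<open>H\<close>. The difference is an integer; if k exceeds
  \<open>H\<close> there are no placements of k rooks.\<close>

lemma card_rook_placements_add_column:
  assumes fin: "finite B" and c: "c \<notin> snd ` B" and H: "fst ` B \<subseteq> {..<H}"
  shows "int (card (rook_placements (B \<union> {..<H} \<times> {c}) (Suc k))) =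
    int (card (rook_placements B (Suc k))) + (int H - int k) * int (card (rook_placements B k))"
proof -
  let ?add = "\<lambda>(T, i). insert (i, c) T"
  let ?X = "SIGMA T:rook_placements B k. {..<H} - fst ` T"
  have eq: "rook_placements (B \<union> {..<H} \<times> {c}) (Suc k) = rook_placements B (Suc k) \<union> ?add ` ?X"
  proof (intro equalityI subsetI)
    fix S assume S: "S \<in> rook_placements (B \<union> {..<H} \<times> {c}) (Suc k)"
    show "S \<in> rook_placements B (Suc k) \<union> ?add ` ?X"
    proof (cases "S \<subseteq> B")
      case True
      then show ?thesis using S by (auto simp: rook_placements_def)
    next
      case False
      then obtain i where i: "(i, c) \<in> S" "i < H"
        using S by (auto simp: rook_placements_def)
      define T where "T = S - {(i, c)}"
      have rook: "\<forall>x\<in>S. \<forall>y\<in>S. x \<noteq> y \<longrightarrow> fst x \<noteq> fst y \<and> snd x \<noteq> snd y"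
        using S by (simp add: rook_placements_def)
      have "x \<in> B" if "x \<in> T" for x
      proof -
        have "snd x \<noteq> c" using that rook i(1) unfolding T_def by fastforce
        then show ?thesis using that S by (auto simp: T_def rook_placements_def)
      qed
      then have "T \<in> rook_placements B k"
        using S i(1) rook by (auto simp: rook_placements_def T_def)
      moreover have "i \<notin> fst ` T" using rook i(1) by (fastforce simp: T_def)
      ultimately have "(T, i) \<in> ?X" using i(2) by simp
      moreover have "S = ?add (T, i)" using i(1) by (auto simp: T_def)
      ultimately show ?thesis by blast
    qed
  next
    fix S assume "S \<in> rook_placements B (Suc k) \<union> ?add ` ?X"
    then show "S \<in> rook_placements (B \<union> {..<H} \<times> {c}) (Suc k)"
    proof
      assume "S \<in> rook_placements B (Suc k)"
      then show ?thesis by (auto simp: rook_placements_def)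
    next
      assume "S \<in> ?add ` ?X"
      then obtain T i where T: "T \<in> rook_placements B k" "i < H" "i \<notin> fst ` T" and S: "S = insert (i, c) T"
        by auto
      have TB: "T \<subseteq> B" "finite T" "card T = k" using T(1) by (auto simp: rook_placements_def)
      have "(i, c) \<notin> T" using TB(1) c by force
      then have "card S = Suc k" using TB by (simp add: S)
      moreover have "\<forall>d\<in>T. fst d \<noteq> i \<and> snd d \<noteq> c" using T(3) TB(1) c by force
      ultimately show ?thesis using T TB by (auto simp: rook_placements_def S)
    qed
  qed
  have notin: "(i, c) \<notin> T" if "T \<in> rook_placements B n" for T i n
    using that c by (force simp: rook_placements_def)
  have inj: "inj_on ?add ?X"
  proof (rule inj_onI, clarify)
    fix T i T' i'
    assume T: "T \<in> rook_placements B k" "T' \<in> rook_placements B k"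
      and ins: "insert (i, c) T = insert (i', c) T'"
    have "i = i'" using ins notin[OF T(2), of i] by blast
    moreover have "T = T'" using ins notin[OF T(1), of i] notin[OF T(2), of i] \<open>i = i'\<close>
      by (simp add: insert_ident)
    ultimately show "T = T' \<and> i = i'" by blast
  qed
  have disj: "rook_placements B (Suc k) \<inter> ?add ` ?X = {}"
    using notin by fastforce
  have "int (card ({..<H} - fst ` T)) = int H - int k" if "T \<in> rook_placements B k" for T
  proof -
    have "fst ` T \<subseteq> {..<H}" using that H by (auto simp: rook_placements_def)
    moreover from this have "card (fst ` T) \<le> H" using card_mono[of "{..<H}" "fst ` T"] by simp
    ultimately show ?thesis
      using card_image_rook_placement(1)[OF that] by (simp add: card_Diff_subset finite_subset of_nat_diff)
  qed
  then have "int (card ?X) = (int H - int k) * int (card (rook_placements B k))"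
    using finite_rook_placements[OF fin] by (simp add: mult.commute)
  moreover have "finite ?X" using finite_rook_placements[OF fin] by simp
  ultimately show ?thesis
    unfolding eq using disj finite_rook_placements[OF fin] by (simp add: card_Un_disjoint card_image[OF inj])
qed

section \<open>The rook polynomial and its linear factors\<close>

definition falling :: "int \<Rightarrow> nat \<Rightarrow> int" where
  "falling x n = (\<Prod>i<n. x - int i)"

text \<open>The factorial rook polynomial of Goldman, Joichi and White, intended for boards with at
  most \<open>m\<close> columns.\<close>

definition rook_poly :: "(nat \<times> nat) set \<Rightarrow> nat \<Rightarrow> int \<Rightarrow> int" where
  "rook_poly B m x = (\<Sum>k\<le>m. int (card (rook_placements B k)) * falling x (m - k))"

lemma rook_poly_add_column:
  assumes fin: "finite B" and c: "c \<notin> snd ` B" and H: "fst ` B \<subseteq> {..<H}"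
    and m: "card (snd ` B) \<le> m"
  shows "rook_poly (B \<union> {..<H} \<times> {c}) (Suc m) x = (x + int H - int m) * rook_poly B m x"
proof -
  let ?r = "\<lambda>k. int (card (rook_placements B k))"
  have "rook_poly (B \<union> {..<H} \<times> {c}) (Suc m) x =
      falling x (Suc m) + (\<Sum>k\<le>m. (?r (Suc k) + (int H - int k) * ?r k) * falling x (m - k))"
    unfolding rook_poly_def sum.atMost_Suc_shift
    by (simp add: rook_placements_0 card_rook_placements_add_column[OF fin c H])
  also have "\<dots> = falling x (Suc m) + (\<Sum>k\<le>m. ?r (Suc k) * falling x (m - k)) +
      (\<Sum>k\<le>m. (int H - int k) * ?r k * falling x (m - k))"
    by (simp add: distrib_right sum.distrib)
  also have "falling x (Suc m) + (\<Sum>k\<le>m. ?r (Suc k) * falling x (m - k)) =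
      (\<Sum>k\<le>Suc m. ?r k * falling x (Suc m - k))"
    unfolding sum.atMost_Suc_shift by (simp add: rook_placements_0)
  \<comment> \<open>The term k = m + 1 vanishes: rooks need distinct columns and there are at most
    \<open>m\<close>.\<close>
  also have "\<dots> = (\<Sum>k\<le>m. ?r k * falling x (Suc m - k))"
    using card_rook_placements_eq_0[OF fin, of "Suc m"] m by simp
  also have "\<dots> = (\<Sum>k\<le>m. (x - int (m - k)) * (?r k * falling x (m - k)))"
    by (intro sum.cong) (auto simp: Suc_diff_le falling_def)
  \<comment> \<open>The factors x - (m - k) and H - k add up to x + H - m, which is free of
    k.\<close>
  also have "\<dots> + (\<Sum>k\<le>m. (int H - int k) * ?r k * falling x (m - k)) =
      (\<Sum>k\<le>m. (x + int H - int m) * (?r k * falling x (m - k)))"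
    unfolding sum.distrib[symmetric] by (intro sum.cong) (auto simp: of_nat_diff algebra_simps)
  finally show ?thesis by (simp add: rook_poly_def sum_distrib_left)
qed

text \<open>Columns are added from right to left, so that each new one is at least as tall as those
  present. Column j joins w - j - 1 others, which makes its factor x + H j - (w - j - 1).\<close>

lemma rook_poly_Ferrers:
  assumes "antimono H" "a \<le> w"
  shows "rook_poly {(i, j). a \<le> j \<and> j < w \<and> i < H j} (w - a) x =
    (\<Prod>j=a..<w. x + int (Suc j + H j) - int w)"
  using assms(2)
proof (induction rule: inc_induct)
  case base
  have "{(i, j). w \<le> j \<and> j < w \<and> i < H j} = {}" by auto
  then show ?case by (simp add: rook_poly_def rook_placements_0 falling_def)
next
  case (step a)
  let ?B = "{(i, j). Suc a \<le> j \<and> j < w \<and> i < H j}"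
  have sub: "?B \<subseteq> {..<H a} \<times> {Suc a..<w}"
    using antimonoD[OF assms(1), of a] by (fastforce simp: less_le_trans)
  then have fin: "finite ?B" by (rule finite_subset) simp
  have "card (snd ` ?B) \<le> card {Suc a..<w}" by (rule card_mono) auto
  then have cols: "card (snd ` ?B) \<le> w - Suc a" by simp
  have B: "{(i, j). a \<le> j \<and> j < w \<and> i < H j} = ?B \<union> {..<H a} \<times> {a}"
    using step by (auto simp: le_eq_less_or_eq Suc_le_eq)
  have w: "w - a = Suc (w - Suc a)" using step by simp
  have "rook_poly {(i, j). a \<le> j \<and> j < w \<and> i < H j} (w - a) x =
      (x + int (H a) - int (w - Suc a)) * rook_poly ?B (w - Suc a) x"
    unfolding B w using sub by (intro rook_poly_add_column[OF fin _ _ cols]) force+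
  then show ?case
    using step by (simp add: prod.atLeast_Suc_lessThan of_nat_diff algebra_simps)
qed

text \<open>At x = i all falling factorials of degree above i vanish and that of degree i does not,
  so the coefficients can be compared by increasing degree.\<close>

lemma falling_basis:
  assumes "\<And>x. (\<Sum>k\<le>m. a k * falling x (m - k)) = (\<Sum>k\<le>m. b k * falling x (m - k))" "k \<le> m"
  shows "a k = b k"
proof -
  have "a (m - i) = b (m - i)" if "i \<le> m" for i
    using that
  proof (induction i rule: less_induct)
    case (less i)
    have "(\<Sum>k\<le>m. (a k - b k) * falling (int i) (m - k)) = 0"
      using assms(1)[of "int i"] by (simp add: left_diff_distrib sum_subtractf)
    also have "(\<Sum>k\<le>m. (a k - b k) * falling (int i) (m - k)) =
        (\<Sum>k\<in>{m - i}. (a k - b k) * falling (int i) (m - k))"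
    proof (rule sum.mono_neutral_right)
      show "\<forall>k \<in> {..m} - {m - i}. (a k - b k) * falling (int i) (m - k) = 0"
      proof
        fix k assume k: "k \<in> {..m} - {m - i}"
        show "(a k - b k) * falling (int i) (m - k) = 0"
        proof (cases "m - k < i")
          case True
          then have "a (m - (m - k)) = b (m - (m - k))" using k less by (intro less.IH) auto
          then show ?thesis using k by simp
        next
          case False
          then have "i < m - k" using k by auto
          then show ?thesis by (auto simp: falling_def)
        qed
      qed
    qed auto
    finally have "(a (m - i) - b (m - i)) * falling (int i) i = 0" using less.prems by simp
    moreover have "falling (int i) i \<noteq> 0" by (simp add: falling_def)
    ultimately show ?case by simp
  qed
  from this[of "m - k"] assms(2) show ?thesis by simp
qed

text \<open>Unique factorization into monic linear factors: each label b is seen as the root c - b,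
  and common factors are cancelled one by one.\<close>

lemma mset_eq_of_linear_factors:
  assumes "\<And>x::int. (\<Prod>b\<leftarrow>bs. x + int b - c) = (\<Prod>b\<leftarrow>ds. x + int b - c)"
  shows "mset bs = mset ds"
proof -
  let ?p = "\<lambda>bs. \<Prod>b\<leftarrow>bs. [:int b - c, 1:]"
  have ev: "poly (?p bs) x = (\<Prod>b\<leftarrow>bs. x + int b - c)" for bs x
    by (induction bs) (simp_all add: algebra_simps)
  have root: "poly (?p bs) (c - int b) = 0 \<longleftrightarrow> b \<in> set bs" for b bs
    unfolding ev by (auto simp: prod_list_zero_iff)
  have "poly (?p bs) = poly (?p ds)" using assms by (simp add: ev fun_eq_iff)
  then have "?p bs = ?p ds" by (simp only: poly_eq_poly_eq_iff)
  then show ?thesis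
  proof (induction bs arbitrary: ds)
    case Nil
    show ?case
    proof (cases ds)
      case (Cons d ds')
      then have "poly (?p ds) (c - int d) = 0" unfolding root by simp
      then show ?thesis unfolding Nil[symmetric] root by simp
    qed simp
  next
    case (Cons b bs)
    have "poly (?p ds) (c - int b) = 0" unfolding Cons.prems[symmetric] root by simp
    then have "b \<in> set ds" unfolding root .
    then obtain ys zs where ds: "ds = ys @ b # zs" by (meson split_list)
    have "[:int b - c, 1:] * ?p bs = [:int b - c, 1:] * ?p (ys @ zs)"
      using Cons.prems by (simp add: ds mult.left_commute del: mult_pCons_left mult_pCons_right)
    then have "?p bs = ?p (ys @ zs)" by (subst (asm) mult_left_cancel) simp_all
    then have "mset bs = mset (ys @ zs)" by (rule Cons.IH)
    then show ?case by (simp add: ds)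
  qed
qed

lemma rook_poly_labels:
  assumes "is_partition \<mu>"
  shows "rook_poly (ferrers \<mu>) (width \<mu>) x = (\<Prod>b\<leftarrow>labels \<mu>. x + int b - int (width \<mu>))"
proof -
  define H where "H = (\<lambda>j. card {i. \<mu> i > j})"
  have H_iff: "i < H j \<longleftrightarrow> j < \<mu> i" for i j
    unfolding H_def by (rule is_partition_less_iff[OF assms, symmetric])
  have "antimono H" by (rule antimonoI) (metis H_iff le_less_trans less_irrefl linorder_not_less)
  have "j < width \<mu>" if "j < \<mu> i" for i j
    using that assms antimonoD[of \<mu> 0 i] by (simp add: is_partition_def width_def)
  then have board: "ferrers \<mu> = {(i, j). 0 \<le> j \<and> j < width \<mu> \<and> i < H j}"
    by (auto simp: ferrers_def H_iff)
  have height: "col_height (parts \<mu>) (Suc j) = H j" for j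
  proof -
    define L where "L = card {i. \<mu> i > 0}"
    have L: "i < L" if "j < \<mu> i" for i
      using is_partition_less_iff[OF assms, of 0 i] that unfolding L_def[symmetric] by simp
    have "col_height (parts \<mu>) (Suc j) = card {i. i < L \<and> j < \<mu> i}"
      unfolding col_height_def parts_def L_def[symmetric] filter_map length_map length_filter_conv_card
      by (rule arg_cong[of _ _ card]) (auto simp: Suc_le_eq)
    also have "{i. i < L \<and> j < \<mu> i} = {i. j < \<mu> i}" using L by blast
    finally show ?thesis by (simp add: H_def)
  qed
  \<comment> \<open>Columns of the board count from 0 and labels from 1, so column j carries the
    label of l = j + 1.\<close>
  have "labels \<mu> = map (\<lambda>j. Suc j + H j) [0..<width \<mu>]"
    unfolding labels_def One_nat_def map_Suc_upt[symmetric]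
    by (simp add: height)
  then have "(\<Prod>b\<leftarrow>labels \<mu>. x + int b - int (width \<mu>)) =
      (\<Prod>j=0..<width \<mu>. x + int (Suc j + H j) - int (width \<mu>))"
    by (simp add: o_def prod.list_conv_set_nth)
  then show ?thesis
    using rook_poly_Ferrers[OF \<open>antimono H\<close>, of 0 "width \<mu>" x] by (simp add: board)
qed

text \<open>The rook polynomial with \<open>m\<close> equal to the common width determines, and is
  determined by, the rook numbers up to the width; beyond it they vanish because the columns run
  out.\<close>

lemma rook_equivalent_iff_labels:
  assumes \<mu>: "is_partition \<mu>" and \<tau>: "is_partition \<tau>" and wd: "width \<mu> = width \<tau>"
  shows "rook_equivalent \<mu> \<tau> \<longleftrightarrow> mset (labels \<mu>) = mset (labels \<tau>)"
proof
  assume "rook_equivalent \<mu> \<tau>"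
  then have "rook_poly (ferrers \<mu>) (width \<mu>) x = rook_poly (ferrers \<tau>) (width \<mu>) x" for x
    by (simp add: rook_equivalent_def rook_poly_def)
  then show "mset (labels \<mu>) = mset (labels \<tau>)"
    using rook_poly_labels[OF \<mu>] rook_poly_labels[OF \<tau>] wd
    by (intro mset_eq_of_linear_factors[where c = "int (width \<mu>)"]) simp
next
  assume eq: "mset (labels \<mu>) = mset (labels \<tau>)"
  have "(\<Prod>b\<leftarrow>labels \<mu>. x + int b - int (width \<mu>)) = (\<Prod>b\<leftarrow>labels \<tau>. x + int b - int (width \<mu>))" for x
    using arg_cong[OF eq, of "\<lambda>M. \<Prod>b\<in>#M. x + int b - int (width \<mu>)"]
    by (simp add: prod_mset_prod_list flip: mset_map)
  then have poly: "rook_poly (ferrers \<mu>) (width \<mu>) x = rook_poly (ferrers \<tau>) (width \<mu>) x" for x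
    using rook_poly_labels[OF \<mu>] rook_poly_labels[OF \<tau>] wd by simp
  have small: "card (rook_placements (ferrers \<mu>) j) = card (rook_placements (ferrers \<tau>) j)"
    if "j \<le> width \<mu>" for j
    using falling_basis[OF poly[unfolded rook_poly_def] that] by simp
  have large: "card (rook_placements (ferrers \<mu>) j) = 0" if "is_partition \<mu>" "width \<mu> < j" for \<mu> j
  proof -
    have "\<mu> i \<le> width \<mu>" for i
      using that(1) antimonoD[of \<mu> 0 i] by (simp add: is_partition_def width_def)
    then have "ferrers \<mu> \<subseteq> {i. \<mu> i > 0} \<times> {..<width \<mu>}"
      by (auto simp: ferrers_def intro: less_le_trans)
    moreover have "finite {i. \<mu> i > 0}" using that by (simp add: is_partition_def)
    ultimately have fin: "finite (ferrers \<mu>)" and "snd ` ferrers \<mu> \<subseteq> {..<width \<mu>}"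
      by (auto intro: finite_subset)
    from this(2) have "card (snd ` ferrers \<mu>) \<le> width \<mu>"
      using card_mono[of "{..<width \<mu>}"] by fastforce
    then show ?thesis using that fin by (intro card_rook_placements_eq_0) auto
  qed
  show "rook_equivalent \<mu> \<tau>"
    unfolding rook_equivalent_def using small large[OF \<mu>] large[OF \<tau>] wd by (metis not_le)
qed

theorem theorem3p1:
  fixes \<mu> \<tau> :: "nat \<Rightarrow> nat"
  assumes "nonempty_partition \<mu>" and "nonempty_partition \<tau>"
    and "weight \<mu> = weight \<tau>" and "width \<mu> = width \<tau>"
  shows "(width_Wilf_equivalent \<mu> \<tau> \<longleftrightarrow> F \<mu> 1 = F \<tau> 1) \<and>
         (F \<mu> 1 = F \<tau> 1 \<longleftrightarrow> rook_equivalent \<mu> \<tau>)"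
proof -
  have "rook_equivalent \<mu> \<tau> \<longleftrightarrow> mset (labels \<mu>) = mset (labels \<tau>)"
    using assms by (intro rook_equivalent_iff_labels) (auto simp: nonempty_partition_def)
  moreover have "F \<mu> 1 = F \<tau> 1" if "width_Wilf_equivalent \<mu> \<tau>"
    using that assms(4) by (simp add: F_def P_def width_Wilf_equivalent_def)
  ultimately show ?thesis
    using F_imp_labels[OF assms] labels_imp_width_Wilf[OF assms] by blast
qed

end
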